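(* Let $\mathcal H$ be a real Hilbert space, $C\subseteq\mathcal H$ nonempty closed convex, and let $B\colon\mathcal H\to\mathcal H$ be monotone and $L$-Lipschitz ($L>0$) with $S\neq\varnothing$. Let $\lambda\in(0,(\sqrt2-1)/L)$, let $x_{-1}=x_0\in C$, let $(\xi_n)_{n\ge0}\subset\mathcal H$ be an arbitrary sequence with $\sum_n\|\xi_n\|<\infty$, and define for $n\ge0$ $$y_n=2x_n-x_{n-1},\qquad x_{n+1}=P_C\bigl(x_n-\lambda(B(y_n)-\xi_n)\bigr).$$ Then $(x_n)$ converges weakly to a point of $S$, with $\|x_{n+1}-x_n\|\to0$.
   Context: $P_C$ is the metric projection onto $C$. Monotone means $\langle B(x)-B(y),x-y\rangle\ge0$ for all $x,y\in\mathcal H$; $L$-Lipschitz means $\|B(x)-B(y)\|\le L\|x-y\|$. The solution set is $S=\{z\in C:\langle B(z),x-z\rangle\ge0\ \forall x\in C\}$. *)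

theory Defs
  imports "HOL-Analysis.Analysis"
begin

text \<open>Same as \<^const>\<open>closest_point\<close>, whose type is restricted to \<^class>\<open>heine_borel\<close> and so
  excludes infinite-dimensional spaces. On nonempty closed convex subsets of a Hilbert space
  the point chosen exists and is unique.\<close>

definition metric_projection :: "'a::real_inner set \<Rightarrow> 'a \<Rightarrow> 'a" where
  "metric_projection C a = (SOME x. x \<in> C \<and> (\<forall>y\<in>C. dist a x \<le> dist a y))"

definition monotone_operator :: "('a::real_inner \<Rightarrow> 'a) \<Rightarrow> bool" where
  "monotone_operator B \<longleftrightarrow> (\<forall>x y. 0 \<le> (B x - B y) \<bullet> (x - y))"

definition vi_solutions :: "'a::real_inner set \<Rightarrow> ('a \<Rightarrow> 'a) \<Rightarrow> 'a set" where
  "vi_solutions C B = {z \<in> C. \<forall>x\<in>C. 0 \<le> B z \<bullet> (x - z)}"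

text \<open>Intended for Hilbert spaces, whose weak topology is the one induced by the
  functionals \<open>\<lambda>x. x \<bullet> u\<close>.\<close>

definition weakly_converges :: "(nat \<Rightarrow> 'a::real_inner) \<Rightarrow> 'a \<Rightarrow> bool" where
  "weakly_converges x z \<longleftrightarrow> (\<forall>u. (\<lambda>n. x n \<bullet> u) \<longlonglongrightarrow> z \<bullet> u)"

end

theory Submission
  imports Defs
begin

text \<open>For a solution \<open>z\<close> put
  \<open>A n = \<parallel>x (n+1) - z\<parallel>\<^sup>2 + lam L \<parallel>x (n+1) - y n\<parallel>\<^sup>2 + 2 lam \<langle>B z, x n - z\<rangle>\<close>.
  Malitsky's estimate for the projected reflected gradient method shows that \<open>A\<close> decreases by at
  least \<open>2 lam \<langle>B z, x (n+1) - z\<rangle> + \<delta> (\<parallel>x (n+1) - y (n+1)\<parallel>\<^sup>2 + \<parallel>x (n+2) - y (n+1)\<parallel>\<^sup>2)\<close>,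
  where \<open>\<delta> = 1 - (1 + sqrt 2) lam L > 0\<close>, up to an error that is linear in the distances to \<open>z\<close> with summable coefficients. The linear growth of the error
  against the quadratic growth of \<open>A\<close> bounds the iterates, so \<open>A\<close> converges, the decrements vanish
  and \<open>\<parallel>x n - z\<parallel>\<close> converges. For \<open>w \<in> C\<close> the projection inequality gives
  \<open>limsup \<langle>B w, x n - w\<rangle> \<le> 0\<close>, which by Minty's lemma puts every point of the intersection of the
  closed convex hulls of the tails into the solution set; Opial's argument shows that this
  intersection is a single point, the weak limit.\<close>

section \<open>Closed convex sets in Hilbert space\<close>

text \<open>Almost norm-minimal points \<open>v n\<close> of \<open>K n\<close> form a Cauchy
  sequence by the parallelogram law; boundedness of \<open>K 0\<close> makes the increasing
  distances \<open>d n\<close> converge. This yields both the existence of projections and a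
  substitute for weak compactness.\<close>

lemma nested_closed_convex_Inter_nonempty:
  fixes K :: "nat \<Rightarrow> 'a::{real_inner, complete_space} set"
  assumes closed: "\<And>n. closed (K n)" and convex: "\<And>n. convex (K n)"
    and nonempty: "\<And>n. K n \<noteq> {}" and decr: "decseq K" and bounded: "bounded (K 0)"
  shows "(\<Inter>n. K n) \<noteq> {}"
proof -
  define d where "d n = infdist 0 (K n)" for n
  have sub: "K m \<subseteq> K n" if "n \<le> m" for m n
    using decr that by (auto simp: decseq_def)
  have d_le: "d n \<le> norm v" if "v \<in> K n" for n v
    using infdist_le[OF that, of 0] by (simp add: d_def)
  have ex: "\<exists>v\<in>K n. norm v < d n + inverse (real (Suc n))" for n
  proof -
    have "(INF a\<in>K n. dist 0 a) < d n + inverse (real (Suc n))"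
      using nonempty[of n] by (simp add: d_def infdist_notempty)
    then show ?thesis
      using nonempty[of n] by (auto dest!: cInf_lessD[rotated])
  qed
  obtain v where v_in: "\<And>n. v n \<in> K n"
    and v_lt: "\<And>n. norm (v n) < d n + inverse (real (Suc n))"
    using ex by metis
  have mono_d: "incseq d"
    unfolding incseq_def d_def
    using nonempty sub by (auto intro!: infdist_mono)
  obtain M where M: "\<And>w. w \<in> K 0 \<Longrightarrow> norm w \<le> M"
    using bounded by (auto simp: bounded_iff)
  have d_bd: "d n \<le> M" for n
    using d_le[OF v_in[of n]] M[of "v n"] v_in[of n] sub[of 0 n] by auto
  obtain D where D: "d \<longlonglongrightarrow> D" and d_D: "\<And>n. d n \<le> D"
    using incseq_convergent[OF mono_d] d_bd by blast
  \<comment> \<open>For \<open>n \<le> m\<close> the parallelogram law bounds the squared distance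
    of \<open>v n\<close> and \<open>v m\<close> by \<open>b n\<close>: both norms are at most
    \<open>D + inverse (real (Suc n))\<close>, and the midpoint, lying in \<open>K n\<close>, has
    norm at least \<open>d n\<close>.\<close>
  define b where "b n = 4 * ((D + inverse (real (Suc n)))\<^sup>2 - (d n)\<^sup>2)" for n
  have b0: "b \<longlonglongrightarrow> 0"
  proof -
    have "b \<longlonglongrightarrow> 4 * ((D + 0)\<^sup>2 - D\<^sup>2)"
      unfolding b_def by (intro tendsto_intros D LIMSEQ_inverse_real_of_nat)
    then show ?thesis by simp
  qed
  have dist_le: "(norm (v n - v m))\<^sup>2 \<le> b n" if "n \<le> m" for m n
  proof -
    have d0: "0 \<le> d n" by (simp add: d_def infdist_nonneg)
    have "(1/2) *\<^sub>R v n + (1/2) *\<^sub>R v m \<in> K n"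
      using convex[of n] v_in[of n] v_in[of m] sub[OF that] by (intro convexD) auto
    then have "(d n)\<^sup>2 \<le> (norm ((1/2) *\<^sub>R v n + (1/2) *\<^sub>R v m))\<^sup>2"
      using d_le d0 by (intro power_mono) auto
    moreover have "(norm (v n))\<^sup>2 \<le> (D + inverse (real (Suc n)))\<^sup>2"
      using v_lt[of n] d_D[of n] by (intro power_mono) auto
    moreover have "inverse (real (Suc m)) \<le> inverse (real (Suc n))"
      using that by (intro le_imp_inverse_le) auto
    then have "(norm (v m))\<^sup>2 \<le> (D + inverse (real (Suc n)))\<^sup>2"
      using v_lt[of m] d_D[of m] by (intro power_mono norm_ge_zero) linarith
    moreover have "(norm (v n - v m))\<^sup>2
        = 2 * (norm (v n))\<^sup>2 + 2 * (norm (v m))\<^sup>2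
          - 4 * (norm ((1/2) *\<^sub>R v n + (1/2) *\<^sub>R v m))\<^sup>2"
      by (simp add: power2_norm_eq_inner inner_simps inner_commute algebra_simps)
    ultimately show ?thesis
      unfolding b_def by argo
  qed
  have "Cauchy v"
  proof (unfold Cauchy_altdef2, intro allI impI)
    fix e :: real assume "e > 0"
    then have "0 < e\<^sup>2" by simp
    then have "\<forall>\<^sub>F n in sequentially. b n < e\<^sup>2"
      using b0 order_tendstoD(2) by blast
    then obtain N where "b N < e\<^sup>2"
      by (auto simp: eventually_sequentially)
    then have "(norm (v N - v n))\<^sup>2 < e\<^sup>2" if "n \<ge> N" for n
      using dist_le[OF that] by linarith
    then have "norm (v N - v n) < e" if "n \<ge> N" for n
      using that \<open>e > 0\<close> by (meson less_imp_le power_less_imp_less_base)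
    then show "\<exists>N. \<forall>n\<ge>N. dist (v n) (v N) < e"
      unfolding dist_norm by (metis norm_minus_commute)
  qed
  then obtain p where p: "v \<longlonglongrightarrow> p"
    by (auto simp: Cauchy_convergent_iff convergent_def)
  have "p \<in> K n" for n
  proof (rule Lim_in_closed_set[OF closed _ _ p])
    show "\<forall>\<^sub>F m in sequentially. v m \<in> K n"
      using eventually_ge_at_top[of n] by eventually_elim (use v_in sub in blast)
  qed simp
  then show ?thesis by blast
qed

text \<open>The nested sets of near-minimisers of the distance share a point, which is a true
  minimiser. So the choice in \<open>metric_projection\<close> yields a nearest point, and the
  obtuse-angle inequality applies to it.\<close>

lemma metric_projection_properties:
  fixes C :: "'a::{real_inner, complete_space} set"
  assumes "C \<noteq> {}" "closed C" "convex C"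
  shows metric_projection_in: "metric_projection C a \<in> C"
    and metric_projection_dot:
      "\<And>w. w \<in> C \<Longrightarrow> (a - metric_projection C a) \<bullet> (w - metric_projection C a) \<le> 0"
proof -
  define K where "K n = C \<inter> cball a (infdist a C + inverse (real (Suc n)))" for n
  have "(\<Inter>n. K n) \<noteq> {}"
  proof (rule nested_closed_convex_Inter_nonempty)
    show "closed (K n)" "convex (K n)" for n
      unfolding K_def using assms by (auto intro: closed_Int convex_Int)
    show "K n \<noteq> {}" for n
    proof -
      have "(INF c\<in>C. dist a c) < infdist a C + inverse (real (Suc n))"
        using assms(1) by (simp add: infdist_notempty)
      then obtain c where "c \<in> C" "dist a c < infdist a C + inverse (real (Suc n))"
        using assms(1) by (auto dest!: cInf_lessD[rotated])
      then show ?thesis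
        unfolding K_def by (auto intro!: less_imp_le)
    qed
    show "bounded (K 0)"
      unfolding K_def by (meson Int_lower2 bounded_cball bounded_subset)
    show "decseq K"
      unfolding decseq_def K_def
      by (intro allI impI Int_mono order_refl subset_cball add_left_mono le_imp_inverse_le) auto
  qed
  then obtain p where p: "\<And>n. p \<in> K n" by blast
  have "dist a p \<le> infdist a C + 0"
  proof (rule LIMSEQ_le_const)
    show "(\<lambda>n. infdist a C + inverse (real (Suc n))) \<longlonglongrightarrow> infdist a C + 0"
      by (intro tendsto_intros LIMSEQ_inverse_real_of_nat)
    show "\<exists>N. \<forall>n\<ge>N. dist a p \<le> infdist a C + inverse (real (Suc n))"
      using p by (auto simp: K_def)
  qed
  then have "p \<in> C \<and> (\<forall>y\<in>C. dist a p \<le> dist a y)"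
    using p[of 0] infdist_le[of _ C a] by (auto simp: K_def intro: order_trans)
  then have P: "metric_projection C a \<in> C
      \<and> (\<forall>y\<in>C. dist a (metric_projection C a) \<le> dist a y)"
    unfolding metric_projection_def by (rule someI)
  then show "metric_projection C a \<in> C" by simp
  show "(a - metric_projection C a) \<bullet> (w - metric_projection C a) \<le> 0" if "w \<in> C" for w
    using any_closest_point_dot[OF assms(3,2) _ that] P by blast
qed

section \<open>Weak convergence without weak compactness\<close>

text \<open>For a bounded sequence this intersection is nonempty and replaces weak cluster points.\<close>

definition tail_hulls :: "(nat \<Rightarrow> 'a::real_normed_vector) \<Rightarrow> 'a set" where
  "tail_hulls x = (\<Inter>n. closure (convex hull (x ` {n..})))"

lemma tail_hulls_nonempty:
  fixes x :: "nat \<Rightarrow> 'a::{real_inner, complete_space}"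
  assumes "bounded (range x)"
  shows "tail_hulls x \<noteq> {}"
  unfolding tail_hulls_def
proof (rule nested_closed_convex_Inter_nonempty)
  show "decseq (\<lambda>n. closure (convex hull (x ` {n..})))"
    unfolding decseq_def by (intro allI impI closure_mono hull_mono) auto
  have "bounded (x ` {0..})"
    using assms by (rule bounded_subset) auto
  then show "bounded (closure (convex hull (x ` {0..})))"
    by (intro bounded_closure bounded_convex_hull)
qed (auto simp: convex_closure convex_convex_hull)

lemma tail_hulls_subset:
  assumes "\<forall>\<^sub>F n in sequentially. x n \<in> T" "closed T" "convex T"
  shows "tail_hulls x \<subseteq> T"
proof -
  obtain N where "\<And>n. n \<ge> N \<Longrightarrow> x n \<in> T"
    using assms(1) by (auto simp: eventually_sequentially)
  then have "closure (convex hull (x ` {N..})) \<subseteq> T"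
    using assms(2,3) by (intro closure_minimal hull_minimal) auto
  then show ?thesis
    unfolding tail_hulls_def by blast
qed

lemma tail_hulls_subseq:
  assumes "strict_mono k"
  shows "tail_hulls (x \<circ> k) \<subseteq> tail_hulls x"
proof -
  have "(x \<circ> k) ` {n..} \<subseteq> x ` {n..}" for n
    using seq_suble[OF assms] by (force intro: order_trans)
  then have "closure (convex hull ((x \<circ> k) ` {n..})) \<subseteq> closure (convex hull (x ` {n..}))" for n
    by (intro closure_mono hull_mono)
  then show ?thesis
    unfolding tail_hulls_def by blast
qed

text \<open>The second hypothesis encodes that the limsup of \<open>x n \<bullet> u\<close> is at
  most \<open>l\<close>. A closed half-space that contains a tail contains the tail hulls.\<close>

lemma tail_hulls_inner_le:
  assumes "p \<in> tail_hulls x" "\<And>e. e > 0 \<Longrightarrow> \<forall>\<^sub>F n in sequentially. x n \<bullet> u \<le> l + e"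
  shows "p \<bullet> u \<le> l"
proof (rule field_le_epsilon)
  fix e :: real assume "e > 0"
  have "tail_hulls x \<subseteq> {v. u \<bullet> v \<le> l + e}"
    using assms(2)[OF \<open>e > 0\<close>]
    by (intro tail_hulls_subset closed_halfspace_le convex_halfspace_le)
       (simp add: inner_commute)
  then show "p \<bullet> u \<le> l + e"
    using assms(1) by (auto simp: inner_commute)
qed

lemma tail_hulls_inner_lim:
  assumes p: "p \<in> tail_hulls x" and lim: "(\<lambda>n. x n \<bullet> u) \<longlonglongrightarrow> l"
  shows "p \<bullet> u = l"
proof (rule antisym)
  show "p \<bullet> u \<le> l"
  proof (rule tail_hulls_inner_le[OF p])
    fix e :: real assume "e > 0"
    then show "\<forall>\<^sub>F n in sequentially. x n \<bullet> u \<le> l + e"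
      using order_tendstoD(2)[OF lim, of "l + e"] by (auto elim: eventually_mono)
  qed
  have "p \<bullet> (- u) \<le> - l"
  proof (rule tail_hulls_inner_le[OF p])
    fix e :: real assume "e > 0"
    then show "\<forall>\<^sub>F n in sequentially. x n \<bullet> (- u) \<le> - l + e"
      using order_tendstoD(1)[OF lim, of "l - e"] by (auto elim: eventually_mono)
  qed
  then show "l \<le> p \<bullet> u" by simp
qed

text \<open>Otherwise a subsequence stays in a closed half-space that misses \<open>p\<close>. Its
  own tail hulls are nonempty and lie both in that half-space and in \<open>{p}\<close>.\<close>

lemma weakly_converges_if_tail_hulls_singleton:
  fixes x :: "nat \<Rightarrow> 'a::{real_inner, complete_space}"
  assumes bdd: "bounded (range x)" and single: "tail_hulls x = {p}"
  shows "weakly_converges x p"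
proof -
  have upper: "\<forall>\<^sub>F n in sequentially. x n \<bullet> u < a" if "p \<bullet> u < a" for u a
  proof (rule ccontr)
    assume "\<not> ?thesis"
    then have "infinite {n. a \<le> x n \<bullet> u}"
      by (simp add: not_eventually INFM_iff_infinite flip: cofinite_eq_sequentially)
         (simp add: not_less)
    then obtain k :: "nat \<Rightarrow> nat" where k: "strict_mono k" "\<And>n. a \<le> x (k n) \<bullet> u"
      using infinite_enumerate[of "{n. a \<le> x n \<bullet> u}"] by blast
    have "bounded (range (x \<circ> k))"
      using bdd by (rule bounded_subset) auto
    then obtain q where q: "q \<in> tail_hulls (x \<circ> k)"
      using tail_hulls_nonempty by blast
    then have "q = p"
      using tail_hulls_subseq[OF k(1)] single by auto
    have "x (k n) \<bullet> (- u) \<le> - a + e" if "e > 0" for n e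
      using k(2)[of n] that by simp
    then have "q \<bullet> (- u) \<le> - a"
      by (intro tail_hulls_inner_le[OF q]) simp
    then show False
      using \<open>q = p\<close> that by simp
  qed
  show ?thesis
    unfolding weakly_converges_def
  proof (intro allI order_tendstoI)
    fix u a assume "a < p \<bullet> u"
    then show "\<forall>\<^sub>F n in sequentially. a < x n \<bullet> u"
      using upper[of "- u" "- a"] by simp
  qed (rule upper)
qed

text \<open>Opial's argument: if \<open>p\<close> and \<open>q\<close> both lie in \<open>S\<close>, then expanding the squared norms
  shows that \<open>x n \<bullet> (p - q)\<close> converges, so that no two points of the tail hulls differ.\<close>

lemma weakly_converges_Opial:
  fixes x :: "nat \<Rightarrow> 'a::{real_inner, complete_space}"
  assumes bdd: "bounded (range x)" and sub: "tail_hulls x \<subseteq> S"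
    and conv: "\<And>z. z \<in> S \<Longrightarrow> convergent (\<lambda>n. (norm (x n - z))\<^sup>2)"
  shows "\<exists>p\<in>S. weakly_converges x p"
proof -
  have unique: "p = q" if p: "p \<in> tail_hulls x" and q: "q \<in> tail_hulls x" for p q
  proof -
    have "convergent (\<lambda>n. (norm (x n - q))\<^sup>2 - (norm (x n - p))\<^sup>2)"
      using sub that by (intro convergent_diff conv) auto
    then obtain l where l: "(\<lambda>n. (norm (x n - q))\<^sup>2 - (norm (x n - p))\<^sup>2) \<longlonglongrightarrow> l"
      by (auto simp: convergent_def)
    have "(\<lambda>n. (((norm (x n - q))\<^sup>2 - (norm (x n - p))\<^sup>2) + (p \<bullet> p - q \<bullet> q)) / 2)
        \<longlonglongrightarrow> (l + (p \<bullet> p - q \<bullet> q)) / 2"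
      by (intro tendsto_intros l) simp
    moreover have "(\<lambda>n. (((norm (x n - q))\<^sup>2 - (norm (x n - p))\<^sup>2) + (p \<bullet> p - q \<bullet> q)) / 2)
        = (\<lambda>n. x n \<bullet> (p - q))"
      by (simp add: fun_eq_iff power2_norm_eq_inner inner_simps inner_commute)
    ultimately have lim: "(\<lambda>n. x n \<bullet> (p - q)) \<longlonglongrightarrow> (l + (p \<bullet> p - q \<bullet> q)) / 2"
      by simp
    have "(p - q) \<bullet> (p - q) = 0"
      using tail_hulls_inner_lim[OF p lim] tail_hulls_inner_lim[OF q lim]
      by (simp add: inner_diff_left)
    then show ?thesis by simp
  qed
  obtain p where "p \<in> tail_hulls x"
    using tail_hulls_nonempty[OF bdd] by blast
  then have "tail_hulls x = {p}"
    using unique by blast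
  then show ?thesis
    using weakly_converges_if_tail_hulls_singleton[OF bdd] sub by blast
qed

text \<open>Testing \<open>weak\<close> at a point \<open>p + t n *\<^sub>R (w - p)\<close> of the
  segment and dividing by \<open>t n\<close> brings the argument of \<open>B\<close> close to
  \<open>p\<close>; continuity then gives the inequality at \<open>p\<close> itself.\<close>

lemma Minty_vi_solutions:
  assumes "convex C" and cont: "continuous_on UNIV B" and p: "p \<in> C"
    and weak: "\<And>w. w \<in> C \<Longrightarrow> B w \<bullet> (p - w) \<le> 0"
  shows "p \<in> vi_solutions C B"
  unfolding vi_solutions_def
proof (intro CollectI conjI ballI p)
  fix w assume w: "w \<in> C"
  define t where "t n = inverse (real (Suc n))" for n
  have nonneg: "0 \<le> B (p + t n *\<^sub>R (w - p)) \<bullet> (w - p)" for n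
  proof -
    have t: "0 < t n" "t n \<le> 1" by (auto simp: t_def field_simps)
    have "p + t n *\<^sub>R (w - p) = (1 - t n) *\<^sub>R p + t n *\<^sub>R w"
      by (simp add: algebra_simps)
    then have "p + t n *\<^sub>R (w - p) \<in> C"
      using convexD_alt[OF assms(1) p w] t by simp
    from weak[OF this] have "0 \<le> t n * (B (p + t n *\<^sub>R (w - p)) \<bullet> (w - p))"
      by simp
    then show ?thesis
      using t by (simp add: zero_le_mult_iff)
  qed
  have "(\<lambda>n. p + t n *\<^sub>R (w - p)) \<longlonglongrightarrow> p + 0 *\<^sub>R (w - p)"
    unfolding t_def by (intro tendsto_intros LIMSEQ_inverse_real_of_nat)
  then have "(\<lambda>n. B (p + t n *\<^sub>R (w - p))) \<longlonglongrightarrow> B p"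
    using cont by (auto simp: continuous_on_eq_continuous_at intro: isCont_tendsto_compose)
  then have "(\<lambda>n. B (p + t n *\<^sub>R (w - p)) \<bullet> (w - p)) \<longlonglongrightarrow> B p \<bullet> (w - p)"
    by (intro tendsto_intros)
  then show "0 \<le> B p \<bullet> (w - p)"
    using nonneg by (intro LIMSEQ_le_const) auto
qed

section \<open>Perturbed Lyapunov inequalities\<close>

text \<open>Subtracting the partial sums of \<open>e\<close> from \<open>A\<close> leaves a
  decreasing sequence bounded below. Once \<open>A\<close> converges, \<open>D\<close> is squeezed
  between 0 and \<open>A n + e n - A (Suc n)\<close>.\<close>

lemma quasi_Fejer_real:
  fixes A D e :: "nat \<Rightarrow> real"
  assumes A0: "\<And>n. 0 \<le> A n" and D0: "\<And>n. 0 \<le> D n" and e: "summable e"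
    and step: "\<And>n. A (Suc n) + D n \<le> A n + e n"
  shows "convergent A" and "D \<longlonglongrightarrow> 0"
proof -
  define E where "E n = (\<Sum>k<n. e k)" for n
  have E: "convergent E"
    using e by (simp add: E_def[abs_def] summable_iff_convergent)
  then have "Bseq E" by (rule convergent_imp_Bseq)
  then obtain b where b: "\<And>n. \<bar>E n\<bar> \<le> b"
    by (auto simp: Bseq_def)
  have "convergent (\<lambda>n. A n - E n)"
  proof -
    have "A (Suc n) - E (Suc n) \<le> A n - E n" for n
      using step[of n] D0[of n] by (simp add: E_def)
    then have "decseq (\<lambda>n. A n - E n)" by (rule decseq_SucI)
    moreover have "- b \<le> A n - E n" for n
      using A0[of n] b[of n] by (simp add: abs_le_iff)
    ultimately obtain l where "(\<lambda>n. A n - E n) \<longlonglongrightarrow> l"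
      using decseq_convergent[of "\<lambda>n. A n - E n" "- b"] by blast
    then show ?thesis by (rule convergentI)
  qed
  then have "convergent (\<lambda>n. (A n - E n) + E n)"
    using E by (rule convergent_add)
  then show A: "convergent A" by simp
  then obtain l where l: "A \<longlonglongrightarrow> l" by (auto simp: convergent_def)
  have "(\<lambda>n. A n + e n - A (Suc n)) \<longlonglongrightarrow> l + 0 - l"
    by (intro tendsto_intros l summable_LIMSEQ_zero[OF e] LIMSEQ_Suc)
  then show "D \<longlonglongrightarrow> 0"
    using D0 step by (intro real_tendsto_sandwich[of "\<lambda>_. 0" D _ "\<lambda>n. A n + e n - A (Suc n)"])
      (auto intro!: always_eventually simp: algebra_simps)
qed

text \<open>The running maximum \<open>R\<close> of \<open>r\<close> satisfies a quadratic inequality \<open>R\<^sup>2 \<le> a + b * R\<close>.\<close>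

lemma self_bounding_sequence:
  fixes A e r :: "nat \<Rightarrow> real"
  assumes r0: "\<And>n. 0 \<le> r n" and e0: "\<And>n. 0 \<le> e n" and e: "summable e"
    and r_A: "\<And>n. (r (Suc n))\<^sup>2 \<le> A n"
    and step: "\<And>n R. (\<And>k. k \<le> Suc (Suc n) \<Longrightarrow> r k \<le> R) \<Longrightarrow> A (Suc n) \<le> A n + e n * R"
  shows "\<exists>R. \<forall>n. r n \<le> R"
proof -
  define b where "b = suminf e"
  define R0 where "R0 = A 0 + b + r 0 + 1"
  have A0: "0 \<le> A 0"
    using r_A[of 0] by (meson order_trans zero_le_power2)
  have b0: "0 \<le> b"
    unfolding b_def using e e0 by (rule suminf_nonneg)
  have "r N \<le> R0" for N
  proof -
    define R where "R = Max (r ` {..N})"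
    have r_R: "r k \<le> R" if "k \<le> N" for k
      unfolding R_def using that by (intro Max_ge) auto
    have R: "0 \<le> R" using r0[of 0] r_R[of 0] by simp
    have A_le: "A n \<le> A 0 + (\<Sum>k<n. e k) * R" if "Suc n \<le> N" for n
      using that
    proof (induction n)
      case (Suc n)
      then have "A (Suc n) \<le> A n + e n * R"
        by (intro step r_R) auto
      then show ?case
        using Suc by (simp add: algebra_simps)
    qed simp
    obtain k where k: "k \<le> N" "R = r k"
      using Max_in[of "r ` {..N}"] by (auto simp flip: R_def)
    \<comment> \<open>A maximum attained at index 0 escapes \<open>r_A\<close>, which starts at
      \<open>r 1\<close>; the term \<open>r 0 * R\<close> covers that case.\<close>
    have sq: "R\<^sup>2 \<le> A 0 + b * R + r 0 * R"
    proof (cases k)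
      case 0
      have "0 \<le> b * R" using b0 R by simp
      then show ?thesis
        using k 0 A0 by (simp add: power2_eq_square)
    next
      case (Suc n)
      have "(\<Sum>k<n. e k) * R \<le> b * R"
        unfolding b_def using e e0 R by (intro mult_right_mono sum_le_suminf) auto
      then have "R\<^sup>2 \<le> A 0 + b * R"
        using r_A[of n] A_le[of n] k Suc by simp
      moreover have "0 \<le> r 0 * R" using r0 R by simp
      ultimately show ?thesis by simp
    qed
    have "R \<le> R0"
    proof (rule ccontr)
      assume less: "\<not> R \<le> R0"
      then have "1 \<le> R" using A0 b0 r0[of 0] unfolding R0_def by linarith
      then have "A 0 \<le> A 0 * R" using A0 by (simp add: mult_le_cancel_left1)
      then have "R * R \<le> (A 0 + b + r 0) * R"
        using sq by (simp add: power2_eq_square algebra_simps)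
      then have "R \<le> A 0 + b + r 0"
        using \<open>1 \<le> R\<close> by simp
      then show False using less unfolding R0_def by simp
    qed
    then show ?thesis using r_R[of N] by simp
  qed
  then show ?thesis by blast
qed

section \<open>The projected reflected gradient step\<close>

text \<open>The weights fit the Lyapunov function: the coefficient 1 of \<open>q\<^sup>2\<close>
  telescopes, and one more \<open>r\<^sup>2\<close>, spent on the next Lyapunov value, makes both
  other coefficients \<open>1 + sqrt 2\<close>, the reciprocal of the step-size threshold
  \<open>sqrt 2 - 1\<close>.\<close>

lemma sqrt2_Young:
  fixes p q r :: real
  shows "2 * ((p + q) * r) \<le> (1 + sqrt 2) * p\<^sup>2 + q\<^sup>2 + sqrt 2 * r\<^sup>2"
proof -
  define h where "h = sqrt 2 / 2"
  have h: "2 * (h * h) = 1" "0 \<le> h" "sqrt 2 = 2 * h"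
    by (auto simp: h_def)
  \<comment> \<open>The slack is a sum of two squares, a polynomial identity modulo
    \<open>2 * (h * h) = 1\<close>.\<close>
  have "(1 + 2 * h) * p\<^sup>2 + q\<^sup>2 + 2 * h * r\<^sup>2 - 2 * ((p + q) * r)
      = 2 * h * (r - h * (p + q))\<^sup>2 + (1 + h) * (p - (2 * h - 1) * q)\<^sup>2"
    using h(1) by algebra
  moreover have "0 \<le> 2 * h * (r - h * (p + q))\<^sup>2 + (1 + h) * (p - (2 * h - 1) * q)\<^sup>2"
    using h(2) by (intro add_nonneg_nonneg mult_nonneg_nonneg) auto
  ultimately show ?thesis unfolding h(3) by linarith
qed

text \<open>Malitsky's estimate. The two obtuse-angle inequalities at \<open>x1\<close> add up to one with test
  direction \<open>y1 - x2\<close>; \<open>g0\<close> and \<open>g1\<close> are the perturbations.\<close>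

lemma reflected_gradient_step:
  fixes x0 x1 x2 y0 y1 z b0 b1 bz g0 g1 :: "'a::real_inner" and L lam :: real
  assumes y1: "y1 = 2 *\<^sub>R x1 - x0" and lam: "0 \<le> lam"
    and proj_x2: "(x0 - lam *\<^sub>R (b0 - g0) - x1) \<bullet> (x2 - x1) \<le> 0"
    and proj_x0: "(x0 - lam *\<^sub>R (b0 - g0) - x1) \<bullet> (x0 - x1) \<le> 0"
    and proj_z: "(x1 - lam *\<^sub>R (b1 - g1) - x2) \<bullet> (z - x2) \<le> 0"
    and mono: "0 \<le> (b1 - bz) \<bullet> (y1 - z)"
    and lip: "norm (b1 - b0) \<le> L * norm (y1 - y0)"
    and L: "0 \<le> L"
  shows "(norm (x2 - z))\<^sup>2 + lam * L * (norm (x2 - y1))\<^sup>2 + 2 * lam * (bz \<bullet> (x1 - z))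
      + (2 * lam * (bz \<bullet> (x1 - z))
        + (1 - (1 + sqrt 2) * (lam * L)) * ((norm (x1 - y1))\<^sup>2 + (norm (x2 - y1))\<^sup>2))
    \<le> (norm (x1 - z))\<^sup>2 + lam * L * (norm (x1 - y0))\<^sup>2 + 2 * lam * (bz \<bullet> (x0 - z))
      + 2 * lam * (g1 \<bullet> (x2 - z) + g0 \<bullet> (y1 - x2))"
proof -
  have "norm (y1 - y0) \<le> norm (x1 - y1) + norm (x1 - y0)"
    using norm_triangle_ineq[of "y1 - x1" "x1 - y0"] by (simp add: norm_minus_commute)
  then have lip': "norm (b1 - b0) \<le> L * (norm (x1 - y1) + norm (x1 - y0))"
    using lip L by (meson mult_left_mono order_trans)
  have "(b1 - b0) \<bullet> (y1 - x2) \<le> norm (b1 - b0) * norm (x2 - y1)"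
    by (metis norm_cauchy_schwarz norm_minus_commute)
  also have "\<dots> \<le> L * (norm (x1 - y1) + norm (x1 - y0)) * norm (x2 - y1)"
    using lip' by (intro mult_right_mono) auto
  finally have "(2 * lam) * ((b1 - b0) \<bullet> (y1 - x2))
      \<le> (2 * lam) * (L * (norm (x1 - y1) + norm (x1 - y0)) * norm (x2 - y1))"
    using lam by (intro mult_left_mono) auto
  also have "\<dots> = (lam * L) * (2 * ((norm (x1 - y1) + norm (x1 - y0)) * norm (x2 - y1)))"
    by (simp add: algebra_simps)
  also have "\<dots> \<le> (lam * L) * ((1 + sqrt 2) * (norm (x1 - y1))\<^sup>2 + (norm (x1 - y0))\<^sup>2
      + sqrt 2 * (norm (x2 - y1))\<^sup>2)"
    using lam L by (intro mult_left_mono sqrt2_Young) auto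
  finally have young: "(2 * lam) * ((b1 - b0) \<bullet> (y1 - x2)) \<le> \<dots>" .
  have mono': "0 \<le> lam * ((b1 - bz) \<bullet> (y1 - z))"
    using mono lam by simp
  \<comment> \<open>Since \<open>x0 - x1 = x1 - y1\<close>, polarization turns the projection
    inequalities into squared norms, and those of \<open>x1 - x2\<close> cancel. Writing
    \<open>y1 - z\<close> as twice \<open>x1 - z\<close> minus \<open>x0 - z\<close> in the
    monotonicity term yields the factors 4 and 2; half of the former enters the next Lyapunov value,
    half the decrement.\<close>
  have main: "(norm (x2 - z))\<^sup>2 + 4 * lam * (bz \<bullet> (x1 - z))
      + (norm (x1 - y1))\<^sup>2 + (norm (x2 - y1))\<^sup>2
    \<le> (norm (x1 - z))\<^sup>2 + 2 * lam * (bz \<bullet> (x0 - z))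
      + 2 * lam * (g1 \<bullet> (x2 - z) + g0 \<bullet> (y1 - x2)) + (2 * lam) * ((b1 - b0) \<bullet> (y1 - x2))"
    using proj_x2 proj_x0 proj_z mono' unfolding y1 power2_norm_eq_inner
    by (simp add: inner_simps inner_commute algebra_simps)
  show ?thesis
    using main young by (simp add: algebra_simps)
qed

section \<open>Convergence of the perturbed projected reflected gradient method\<close>

theorem lemma5p3:
  fixes C :: "'a::{real_inner, complete_space} set"
    and B :: "'a \<Rightarrow> 'a"
    and L lam :: real
    and x y \<xi> :: "nat \<Rightarrow> 'a"
    and x_minus1 :: 'a
  assumes "C \<noteq> {}" and "closed C" and "convex C"
    and "monotone_operator B"
    and "L > 0" and "L-lipschitz_on UNIV B"
    and "vi_solutions C B \<noteq> {}"
    and "0 < lam" and "lam < (sqrt 2 - 1) / L"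
    and "x_minus1 = x 0" and "x 0 \<in> C"
    and "summable (\<lambda>n. norm (\<xi> n))"
    and "y 0 = 2 *\<^sub>R x 0 - x_minus1"
    and "\<And>n. y (Suc n) = 2 *\<^sub>R x (Suc n) - x n"
    and "\<And>n. x (Suc n) = metric_projection C (x n - lam *\<^sub>R (B (y n) - \<xi> n))"
  shows "(\<exists>z \<in> vi_solutions C B. weakly_converges x z)
    \<and> (\<lambda>n. norm (x (Suc n) - x n)) \<longlonglongrightarrow> 0"
proof -
  note Cne = assms(1) and Ccl = assms(2) and Ccv = assms(3) and Bmon = assms(4)
    and Lpos = assms(5) and Blip = assms(6) and lam0 = assms(8) and lam1 = assms(9)
    and x0 = assms(11) and \<xi>sum = assms(12) and y_Suc = assms(14) and x_Suc = assms(15)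
  \<comment> \<open>Feasibility makes \<open>x n\<close> and \<open>x (Suc (Suc n))\<close>
    admissible test points for the projection defining \<open>x (Suc n)\<close>.\<close>
  have x_C: "x n \<in> C" for n
    using x0 metric_projection_in[OF Cne Ccl Ccv] by (cases n) (simp_all add: x_Suc)
  have proj: "(x n - lam *\<^sub>R (B (y n) - \<xi> n) - x (Suc n)) \<bullet> (w - x (Suc n)) \<le> 0"
    if "w \<in> C" for n w
    using metric_projection_dot[OF Cne Ccl Ccv that] by (simp add: x_Suc)
  have mono: "0 \<le> (B u - B v) \<bullet> (u - v)" for u v
    using Bmon by (simp add: monotone_operator_def)
  have lip: "norm (B u - B v) \<le> L * norm (u - v)" for u v
    using lipschitz_onD[OF Blip, of u v] by (simp add: dist_norm)
  define \<delta> where "\<delta> = 1 - (1 + sqrt 2) * (lam * L)"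
  have \<delta>: "0 < \<delta>"
  proof -
    have "lam * L < sqrt 2 - 1"
      using lam1 Lpos by (simp add: field_simps)
    then have "(1 + sqrt 2) * (lam * L) < (1 + sqrt 2) * (sqrt 2 - 1)"
      by (intro mult_strict_left_mono) (auto intro: add_pos_pos)
    also have "\<dots> = 1" by (simp add: algebra_simps)
    finally show ?thesis unfolding \<delta>_def by simp
  qed
  define A where "A z n = (norm (x (Suc n) - z))\<^sup>2 + lam * L * (norm (x (Suc n) - y n))\<^sup>2
    + 2 * lam * (B z \<bullet> (x n - z))" for z n
  define D where "D z n = 2 * lam * (B z \<bullet> (x (Suc n) - z))
    + \<delta> * ((norm (x (Suc n) - y (Suc n)))\<^sup>2 + (norm (x (Suc (Suc n)) - y (Suc n)))\<^sup>2)" for z n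
  \<comment> \<open>The 4 counts the distances to \<open>z\<close> into which
    \<open>y (Suc n) - x (Suc (Suc n))\<close> splits after inserting
    \<open>y (Suc n) = 2 *\<^sub>R x (Suc n) - x n\<close>.\<close>
  define e where "e n = 2 * lam * (norm (\<xi> (Suc n)) + 4 * norm (\<xi> n))" for n
  have e0: "0 \<le> e n" for n
    using lam0 by (simp add: e_def)
  have e_sum: "summable e"
    unfolding e_def using \<xi>sum summable_Suc_iff[of "\<lambda>n. norm (\<xi> n)"]
    by (intro summable_mult summable_add) auto
  have sol: "0 \<le> B z \<bullet> (x n - z)" if "z \<in> vi_solutions C B" for z n
    using that x_C by (auto simp: vi_solutions_def)
  have D0: "0 \<le> D z n" if "z \<in> vi_solutions C B" for z n
    using sol[OF that] lam0 \<delta> by (simp add: D_def)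
  have A_ge: "(norm (x (Suc n) - z))\<^sup>2 \<le> A z n" if "z \<in> vi_solutions C B" for z n
    using sol[OF that] lam0 Lpos by (simp add: A_def)
  have A0: "0 \<le> A z n" if "z \<in> vi_solutions C B" for z n
    using A_ge[OF that] by (meson order_trans zero_le_power2)
  \<comment> \<open>Only a bound up to index \<open>Suc (Suc n)\<close> is assumed, so the estimate
    first serves to bound the iterates and then, with a global \<open>R\<close>, has the summable
    error \<open>e n * R\<close>.\<close>
  have step: "A z (Suc n) + D z n \<le> A z n + e n * R"
    if z: "z \<in> vi_solutions C B" and R: "\<And>k. k \<le> Suc (Suc n) \<Longrightarrow> norm (x k - z) \<le> R"
    for z n R
  proof -
    have "z \<in> C" using z by (simp add: vi_solutions_def)
    have "A z (Suc n) + D z n \<le> A z n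
        + 2 * lam * (\<xi> (Suc n) \<bullet> (x (Suc (Suc n)) - z) + \<xi> n \<bullet> (y (Suc n) - x (Suc (Suc n))))"
      unfolding A_def D_def \<delta>_def using lam0 Lpos \<open>z \<in> C\<close>
      by (intro reflected_gradient_step[where ?b0.0 = "B (y n)" and ?b1.0 = "B (y (Suc n))"]
          y_Suc proj x_C mono lip) auto
    moreover have "\<xi> (Suc n) \<bullet> (x (Suc (Suc n)) - z) \<le> norm (\<xi> (Suc n)) * R"
      using R[of "Suc (Suc n)"]
      by (intro order_trans[OF norm_cauchy_schwarz] mult_left_mono) auto
    moreover have "\<xi> n \<bullet> (y (Suc n) - x (Suc (Suc n))) \<le> norm (\<xi> n) * (4 * R)"
    proof -
      have "y (Suc n) - x (Suc (Suc n))
          = (x (Suc n) - z) + (x (Suc n) - z) - (x n - z) - (x (Suc (Suc n)) - z)"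
        by (simp add: y_Suc scaleR_2)
      also have "norm \<dots> \<le> norm (x (Suc n) - z) + norm (x (Suc n) - z) + norm (x n - z)
          + norm (x (Suc (Suc n)) - z)"
        by (meson add_right_mono norm_triangle_ineq norm_triangle_ineq4 order_trans)
      also have "\<dots> \<le> 4 * R"
        using R[of n] R[of "Suc n"] R[of "Suc (Suc n)"] by simp
      finally show ?thesis
        by (intro order_trans[OF norm_cauchy_schwarz] mult_left_mono) auto
    qed
    ultimately have "A z (Suc n) + D z n \<le> A z n
        + 2 * lam * (norm (\<xi> (Suc n)) * R + norm (\<xi> n) * (4 * R))"
      using lam0 by (smt (verit) mult_left_mono)
    then show ?thesis
      by (simp add: e_def algebra_simps)
  qed
  have bdd: "\<exists>R. \<forall>n. norm (x n - z) \<le> R" if z: "z \<in> vi_solutions C B" for z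
  proof (rule self_bounding_sequence[where A = "A z" and e = e])
    fix n R assume "\<And>k. k \<le> Suc (Suc n) \<Longrightarrow> norm (x k - z) \<le> R"
    then show "A z (Suc n) \<le> A z n + e n * R"
      using step[OF z, of n R] D0[OF z, of n] by fastforce
  qed (use e0 e_sum A_ge[OF z] in auto)
  have A_conv: "convergent (A z)" and D_lim: "D z \<longlonglongrightarrow> 0" if z: "z \<in> vi_solutions C B" for z
  proof -
    obtain R where R: "\<And>n. norm (x n - z) \<le> R"
      using bdd[OF z] by blast
    show "convergent (A z)" "D z \<longlonglongrightarrow> 0"
      using quasi_Fejer_real[of "A z" "D z" "\<lambda>n. e n * R"] A0[OF z] D0[OF z] step[OF z R]
        summable_mult2[OF e_sum] by auto
  qed
  obtain z0 where z0: "z0 \<in> vi_solutions C B"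
    using assms(7) by blast
  have part_lim: "f \<longlonglongrightarrow> 0"
    if "0 < c" "z \<in> vi_solutions C B" "\<And>n. 0 \<le> f n" "\<And>n. c * f n \<le> D z n"
    for c :: real and f z
  proof (rule real_tendsto_sandwich[of "\<lambda>_. 0" f _ "\<lambda>n. D z n / c"])
    show "(\<lambda>n. D z n / c) \<longlonglongrightarrow> 0"
      using tendsto_divide[OF D_lim[OF that(2)] tendsto_const[of c]] that(1) by simp
  qed (use that in \<open>auto intro!: always_eventually simp: field_simps\<close>)
  have D_parts: "2 * lam * (B z \<bullet> (x (Suc n) - z)) \<le> D z n"
      "\<delta> * (norm (x (Suc n) - y (Suc n)))\<^sup>2 \<le> D z n"
      "\<delta> * (norm (x (Suc (Suc n)) - y (Suc n)))\<^sup>2 \<le> D z n"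
    if "z \<in> vi_solutions C B" for z n
    using sol[OF that, of "Suc n"] lam0 \<delta> by (simp_all add: D_def distrib_left)
  have sq_lim: "f \<longlonglongrightarrow> 0" if "(\<lambda>n. (f n)\<^sup>2) \<longlonglongrightarrow> 0" for f :: "nat \<Rightarrow> real"
    using tendsto_real_sqrt[OF that] by (simp add: tendsto_rabs_zero_iff)
  have inner_lim: "(\<lambda>n. B z \<bullet> (x n - z)) \<longlonglongrightarrow> 0" if z: "z \<in> vi_solutions C B" for z
  proof (rule LIMSEQ_imp_Suc)
    show "(\<lambda>n. B z \<bullet> (x (Suc n) - z)) \<longlonglongrightarrow> 0"
      using lam0 sol[OF z] D_parts(1)[OF z] by (intro part_lim[OF _ z, of "2 * lam"]) auto
  qed
  have xy_lim: "(\<lambda>n. norm (x n - y n)) \<longlonglongrightarrow> 0"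
  proof (rule LIMSEQ_imp_Suc)
    show "(\<lambda>n. norm (x (Suc n) - y (Suc n))) \<longlonglongrightarrow> 0"
      by (rule sq_lim, rule part_lim[OF \<delta> z0]) (use D_parts[OF z0] in auto)
  qed
  have xSy_lim: "(\<lambda>n. norm (x (Suc n) - y n)) \<longlonglongrightarrow> 0"
  proof (rule LIMSEQ_imp_Suc)
    show "(\<lambda>n. norm (x (Suc (Suc n)) - y (Suc n))) \<longlonglongrightarrow> 0"
      by (rule sq_lim, rule part_lim[OF \<delta> z0]) (use D_parts[OF z0] in auto)
  qed
  have diff_lim: "(\<lambda>n. norm (x (Suc n) - x n)) \<longlonglongrightarrow> 0"
  proof (rule real_tendsto_sandwich[of "\<lambda>_. 0"])
    show "(\<lambda>n. norm (x (Suc n) - y n) + norm (x n - y n)) \<longlonglongrightarrow> 0"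
      using tendsto_add[OF xSy_lim xy_lim] by simp
    have "norm (x (Suc n) - x n) \<le> norm (x (Suc n) - y n) + norm (x n - y n)" for n
      using norm_triangle_ineq4[of "x (Suc n) - y n" "x n - y n"] by simp
    then show "\<forall>\<^sub>F n in sequentially.
        norm (x (Suc n) - x n) \<le> norm (x (Suc n) - y n) + norm (x n - y n)"
      by simp
  qed auto
  \<comment> \<open>The other two terms of \<open>A z\<close> vanish in the limit, so the squared
    distance inherits its convergence.\<close>
  have dist_conv: "convergent (\<lambda>n. (norm (x n - z))\<^sup>2)" if z: "z \<in> vi_solutions C B" for z
  proof -
    obtain l where l: "A z \<longlonglongrightarrow> l" using A_conv[OF z] by (auto simp: convergent_def)
    have "(\<lambda>n. A z n - lam * L * (norm (x (Suc n) - y n))\<^sup>2 - 2 * lam * (B z \<bullet> (x n - z)))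
        \<longlonglongrightarrow> l - lam * L * 0\<^sup>2 - 2 * lam * 0"
      by (intro tendsto_intros l xSy_lim inner_lim[OF z])
    then have "(\<lambda>n. (norm (x (Suc n) - z))\<^sup>2) \<longlonglongrightarrow> l"
      by (simp add: A_def)
    then have "(\<lambda>n. (norm (x n - z))\<^sup>2) \<longlonglongrightarrow> l"
      by (rule LIMSEQ_imp_Suc)
    then show ?thesis by (auto simp: convergent_def)
  qed
  obtain M where M: "\<And>n. norm (x n - z0) \<le> M"
    using bdd[OF z0] by blast
  have bounded: "bounded (range x)"
  proof (rule boundedI)
    fix v assume "v \<in> range x"
    then obtain n where "v = x n" by blast
    then show "norm v \<le> M + norm z0"
      using M[of n] norm_triangle_ineq[of "x n - z0" z0] by simp
  qed
  have tails: "tail_hulls x \<subseteq> vi_solutions C B"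
  proof
    fix p assume p: "p \<in> tail_hulls x"
    have "tail_hulls x \<subseteq> C"
      using x_C Ccl Ccv by (intro tail_hulls_subset) auto
    then have "p \<in> C" using p by blast
    moreover have "B w \<bullet> (p - w) \<le> 0" if w: "w \<in> C" for w
    proof -
      \<comment> \<open>The three summands account for the displacement of the projection step, the
        perturbation, and the Lipschitz error of evaluating \<open>B\<close> at \<open>y n\<close>
        instead of \<open>x (Suc n)\<close>; the last factor bounds the distance from
        \<open>x (Suc n)\<close> to \<open>w\<close> via \<open>z0\<close>.\<close>
      define \<epsilon> where "\<epsilon> n = (norm (x (Suc n) - x n) / lam + norm (\<xi> n)
        + L * norm (x (Suc n) - y n)) * (M + norm (z0 - w))" for n
      have "\<epsilon> \<longlonglongrightarrow> (0 / lam + 0 + L * 0) * (M + norm (z0 - w))"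
        unfolding \<epsilon>_def using lam0
        by (intro tendsto_intros diff_lim xSy_lim summable_LIMSEQ_zero[OF \<xi>sum]) auto
      then have \<epsilon>_lim: "\<epsilon> \<longlonglongrightarrow> 0" by simp
      \<comment> \<open>Monotonicity replaces \<open>B w\<close> by \<open>B (x (Suc n))\<close>;
        the projection inequality divided by \<open>lam\<close> then bounds the pairing.\<close>
      have le: "B w \<bullet> (x (Suc n) - w) \<le> \<epsilon> n" for n
      proof -
        have "B w \<bullet> (x (Suc n) - w) \<le> B (x (Suc n)) \<bullet> (x (Suc n) - w)"
          using mono[of "x (Suc n)" w] by (simp add: inner_diff_left)
        also have "\<dots> \<le> ((x n - x (Suc n)) /\<^sub>R lam + \<xi> n + (B (x (Suc n)) - B (y n)))
            \<bullet> (x (Suc n) - w)"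
        proof -
          have "(x n - lam *\<^sub>R (B (y n) - \<xi> n) - x (Suc n)) \<bullet> (w - x (Suc n))
              = lam * ((B (y n) - \<xi> n - (x n - x (Suc n)) /\<^sub>R lam) \<bullet> (x (Suc n) - w))"
            using lam0 by (simp add: inner_simps field_simps)
          then have "(B (y n) - \<xi> n - (x n - x (Suc n)) /\<^sub>R lam) \<bullet> (x (Suc n) - w) \<le> 0"
            using proj[OF w, of n] lam0 by (simp add: mult_le_0_iff)
          then show ?thesis by (simp add: inner_simps algebra_simps)
        qed
        also have "\<dots> \<le> norm ((x n - x (Suc n)) /\<^sub>R lam + \<xi> n + (B (x (Suc n)) - B (y n)))
            * norm (x (Suc n) - w)"
          by (rule norm_cauchy_schwarz)
        also have "\<dots> \<le> \<epsilon> n"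
          unfolding \<epsilon>_def
        proof (rule mult_mono)
          have "norm ((x n - x (Suc n)) /\<^sub>R lam) = norm (x (Suc n) - x n) / lam"
            using lam0 by (simp add: norm_minus_commute divide_inverse_commute)
          then show "norm ((x n - x (Suc n)) /\<^sub>R lam + \<xi> n + (B (x (Suc n)) - B (y n)))
              \<le> norm (x (Suc n) - x n) / lam + norm (\<xi> n) + L * norm (x (Suc n) - y n)"
            using lip[of "x (Suc n)" "y n"] by (intro norm_triangle_mono) auto
          show "norm (x (Suc n) - w) \<le> M + norm (z0 - w)"
            using M[of "Suc n"] norm_triangle_ineq[of "x (Suc n) - z0" "z0 - w"] by simp
        qed (use lam0 Lpos in auto)
        finally show ?thesis .
      qed
      have "p \<bullet> B w \<le> w \<bullet> B w"
      proof (rule tail_hulls_inner_le[OF p])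
        fix \<eta> :: real assume "\<eta> > 0"
        then have "\<forall>\<^sub>F n in sequentially. \<epsilon> n < \<eta>"
          using \<epsilon>_lim order_tendstoD(2) by blast
        then have "\<forall>\<^sub>F n in sequentially. x (Suc n) \<bullet> B w \<le> w \<bullet> B w + \<eta>"
        proof eventually_elim
          case (elim n)
          then show ?case
            using le[of n] by (simp add: inner_diff_right inner_commute)
        qed
        then show "\<forall>\<^sub>F n in sequentially. x n \<bullet> B w \<le> w \<bullet> B w + \<eta>"
          by (subst (asm) eventually_sequentially_Suc)
      qed
      then show ?thesis by (simp add: inner_diff_right inner_commute)
    qed
    ultimately show "p \<in> vi_solutions C B"
      using Minty_vi_solutions[OF Ccv lipschitz_on_continuous_on[OF Blip]] by blast
  qed
  show ?thesis
    using weakly_converges_Opial[OF bounded tails dist_conv] diff_lim by blast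
qed

end
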